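(* Let $f\colon\mathbb{R}^d\to\mathbb{R}$ be $\mu$-strongly convex and $L$-smooth ($\mu>0$), $\kappa=L/\mu$, and let $\mathtt{Alg}$ be a procedure as in the context. Fix $x_{\rm in}\in\mathbb{R}^d$ and $\Delta_{\rm in}>0$ with $\Delta_{\rm in}\ge f(x_{\rm in})-\min f$. Fix $\epsilon>0$ and $p\in(0,1)$, and set $$T=\lceil\log_2\kappa\rceil,\quad m=\left\lceil18\ln\left(\tfrac{2+T}{p}\right)\right\rceil,\quad\delta=\frac{\epsilon}{2+2T},\quad\lambda_i=\mu2^i\ (0\le i\le T).$$ Then the point $x_{T+1}=\mathtt{BoostAlg}(\delta,\Delta_{\rm in},x_{\rm in},T,m)$ (defined in the context) satisfies $$\mathbb{P}\bigl(f(x_{T+1})-\min f\le\epsilon\bigr)\ge1-p.$$ Moreover, the total number of calls to $\mathtt{Alg}$ is $$\left\lceil18\ln\left(\frac{\lceil2+\log_2\kappa\rceil}{p}\right)\right\rceil\lceil2+\log_2\kappa\rceil,$$ while the initialization errors satisfy $$\max_{i=0,\dots,T+1}\Delta_i\le\frac{\kappa+1+2\lceil\log_2\kappa\rceil}{2+2\lceil\log_2\kappa\rceil}\,\epsilon.$$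
   Context: $\mu$-strongly convex means $f-\frac\mu2\|\cdot\|^2$ is convex; $L$-smooth means differentiable with $L$-Lipschitz gradient. $\mathtt{Alg}$: for $x\in\mathbb{R}^d$, $\lambda\ge0$ let $\varphi_x(y)=f(y)+\frac\lambda2\|y-x\|^2$. $\mathtt{Alg}(\delta,\lambda,\Delta,x)$ is a randomized procedure such that, whenever $\delta>0$ and $\Delta>0$ satisfies $\varphi_x(x)-\min\varphi_x\le\Delta$, it returns a point $y$ with $\mathbb{P}[\varphi_x(y)-\min\varphi_x\le\delta]\ge\frac23$. Different calls use fresh independent randomness. $\mathtt{Alg\text{-}R}(\delta,\lambda,\Delta,x,m)$: call $\mathtt{Alg}(\delta,\lambda,\Delta,x)$ independently $m$ times to get $y_1,\dots,y_m$; for each $i$ let $r_i$ be the smallest $r\ge0$ such that more than $m/2$ indices $k$ satisfy $\|y_k-y_i\|\le r$; return $y_{i^*}$ where $i^*$ minimizes $r_i$. $\mathtt{BoostAlg}(\delta,\Delta_{\rm in},x_{\rm in},T,m)$: set $\lambda_{-1}=0$, $\Delta_{-1}=\Delta_{\rm in}$, $x_{-1}=x_{\rm in}$. For $j=0,\dots,T$: set $$x_j=\mathtt{Alg\text{-}R}(\delta/9,\lambda_{j-1},\Delta_{j-1},x_{j-1},m),\qquad \Delta_j=\delta\left(\frac{L+\lambda_{j-1}}{\mu+\lambda_{j-1}}+\sum_{i=0}^{j-1}\frac{\lambda_i}{\mu+\lambda_{i-1}}\right).$$ Return $x_{T+1}=\mathtt{Alg\text{-}R}\left(\frac{\mu+\lambda_T}{L+\lambda_T}\cdot\frac\delta9,\lambda_T,\Delta_T,x_T,m\right)$.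 The quantity $\Delta_{T+1}$ is defined by the same formula for $\Delta_j$ with $j=T+1$. *)

theory Defs
  imports "HOL-Probability.Probability"
begin

definition strongly_convex :: "real \<Rightarrow> ('a::euclidean_space \<Rightarrow> real) \<Rightarrow> bool" where
  "strongly_convex \<mu> f \<longleftrightarrow> convex_on UNIV (\<lambda>x. f x - \<mu> / 2 * (norm x)\<^sup>2)"

definition smooth :: "real \<Rightarrow> ('a::euclidean_space \<Rightarrow> real) \<Rightarrow> bool" where
  "smooth L f \<longleftrightarrow> (\<exists>g. (\<forall>x. GDERIV f x :> g x) \<and> L-lipschitz_on UNIV g)"

text \<open>The minimum of a function; meaningful only when it is attained.\<close>

definition minimum :: "('a \<Rightarrow> real) \<Rightarrow> real" where
  "minimum g = (LEAST v. v \<in> range g)"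

definition prox_obj :: "('a::euclidean_space \<Rightarrow> real) \<Rightarrow> real \<Rightarrow> 'a \<Rightarrow> 'a \<Rightarrow> real" where
  "prox_obj f lam x y = f y + lam / 2 * (norm (y - x))\<^sup>2"

text \<open>
  A randomized procedure is a function of its inputs (in the order
  \<open>\<delta>, \<lambda>, \<Delta>, x\<close>) and of a random seed with law \<open>S\<close>. Joint measurability in the input point
  and the seed is what makes the output a random variable when the input point is itself random.
\<close>

type_synonym ('a, 'w) proc = "real \<Rightarrow> real \<Rightarrow> real \<Rightarrow> 'a \<Rightarrow> 'w \<Rightarrow> 'a"

definition is_alg :: "('a::euclidean_space \<Rightarrow> real) \<Rightarrow> 'w measure \<Rightarrow> ('a, 'w) proc \<Rightarrow> bool" where
  "is_alg f S Alg \<longleftrightarrow>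
     prob_space S \<and>
     (\<forall>\<delta> lam \<Delta>. \<delta> > 0 \<and> lam \<ge> 0 \<and> \<Delta> > 0 \<longrightarrow>
        (\<lambda>(x, w). Alg \<delta> lam \<Delta> x w) \<in> borel \<Otimes>\<^sub>M S \<rightarrow>\<^sub>M borel) \<and>
     (\<forall>\<delta> lam \<Delta> x.
        \<delta> > 0 \<and> lam \<ge> 0 \<and> \<Delta> > 0 \<and>
        prox_obj f lam x x - minimum (prox_obj f lam x) \<le> \<Delta> \<longrightarrow>
        \<P>(w in S. prox_obj f lam x (Alg \<delta> lam \<Delta> x w) - minimum (prox_obj f lam x) \<le> \<delta>) \<ge> 2 / 3)"

text \<open>
  The algorithms below are run on a sequence \<open>\<omega>\<close> of seeds, to be drawn i.i.d. from \<open>S\<close>, and thread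
  through a counter of the calls made to \<open>Alg\<close> so far: call number \<open>n\<close> consumes the seed \<open>\<omega> n\<close>, so
  different calls use independent randomness, and the final counter is the total number of calls.
\<close>

type_synonym ('w, 'r) run = "(nat \<Rightarrow> 'w) \<Rightarrow> nat \<Rightarrow> 'r \<times> nat"

definition call_alg :: "('a, 'w) proc \<Rightarrow> real \<Rightarrow> real \<Rightarrow> real \<Rightarrow> 'a \<Rightarrow> ('w, 'a) run" where
  "call_alg Alg \<delta> lam \<Delta> x \<omega> n = (Alg \<delta> lam \<Delta> x (\<omega> n), Suc n)"

primrec repeat_alg ::
  "('a, 'w) proc \<Rightarrow> real \<Rightarrow> real \<Rightarrow> real \<Rightarrow> 'a \<Rightarrow> nat \<Rightarrow> ('w, 'a list) run" where
  "repeat_alg Alg \<delta> lam \<Delta> x 0 \<omega> n = ([], n)"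
| "repeat_alg Alg \<delta> lam \<Delta> x (Suc m) \<omega> n =
     (let (ys, n') = repeat_alg Alg \<delta> lam \<Delta> x m \<omega> n;
          (y, n'') = call_alg Alg \<delta> lam \<Delta> x \<omega> n'
      in (ys @ [y], n''))"

definition majority_radius :: "'a::euclidean_space list \<Rightarrow> nat \<Rightarrow> real" where
  "majority_radius ys i =
     (LEAST r. r \<ge> 0 \<and>
        real (card {k. k < length ys \<and> norm (ys ! k - ys ! i) \<le> r}) > real (length ys) / 2)"

definition radius_minimizers :: "'a::euclidean_space list \<Rightarrow> nat set" where
  "radius_minimizers ys =
     {i. i < length ys \<and> (\<forall>k < length ys. majority_radius ys i \<le> majority_radius ys k)}"

text \<open>The function \<open>tie\<close> selects one index from the set of minimizing indices.\<close>

definition alg_R ::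
  "(nat set \<Rightarrow> nat) \<Rightarrow> ('a::euclidean_space, 'w) proc \<Rightarrow> real \<Rightarrow> real \<Rightarrow> real \<Rightarrow> 'a \<Rightarrow> nat
   \<Rightarrow> ('w, 'a) run" where
  "alg_R tie Alg \<delta> lam \<Delta> x m \<omega> n =
     (let (ys, n') = repeat_alg Alg \<delta> lam \<Delta> x m \<omega> n
      in (ys ! tie (radius_minimizers ys), n'))"

text \<open>
  Sequences starting at index \<open>-1\<close> are shifted: for a sequence \<open>s\<close> on the natural numbers with
  value \<open>a\<close> at \<open>-1\<close>, the term with index \<open>j - 1\<close> is \<open>case_nat a s j\<close>.
\<close>

definition boost_Delta :: "real \<Rightarrow> real \<Rightarrow> (nat \<Rightarrow> real) \<Rightarrow> real \<Rightarrow> nat \<Rightarrow> real" where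
  "boost_Delta L \<mu> lam \<delta> j =
     \<delta> * ((L + case_nat 0 lam j) / (\<mu> + case_nat 0 lam j) +
          (\<Sum>i<j. lam i / (\<mu> + case_nat 0 lam i)))"

text \<open>\<open>boost_loop \<dots> j\<close> returns the iterate with index \<open>j - 1\<close>.\<close>

primrec boost_loop ::
  "(nat set \<Rightarrow> nat) \<Rightarrow> ('a::euclidean_space, 'w) proc \<Rightarrow> real \<Rightarrow> real \<Rightarrow> (nat \<Rightarrow> real)
   \<Rightarrow> real \<Rightarrow> real \<Rightarrow> 'a \<Rightarrow> nat \<Rightarrow> nat \<Rightarrow> ('w, 'a) run" where
  "boost_loop tie Alg L \<mu> lam \<delta> \<Delta>in xin m 0 \<omega> n = (xin, n)"
| "boost_loop tie Alg L \<mu> lam \<delta> \<Delta>in xin m (Suc j) \<omega> n =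
     (let (x, n') = boost_loop tie Alg L \<mu> lam \<delta> \<Delta>in xin m j \<omega> n
      in alg_R tie Alg (\<delta> / 9) (case_nat 0 lam j)
           (case_nat \<Delta>in (boost_Delta L \<mu> lam \<delta>) j) x m \<omega> n')"

definition boost_alg ::
  "(nat set \<Rightarrow> nat) \<Rightarrow> ('a::euclidean_space, 'w) proc \<Rightarrow> real \<Rightarrow> real \<Rightarrow> (nat \<Rightarrow> real)
   \<Rightarrow> real \<Rightarrow> real \<Rightarrow> 'a \<Rightarrow> nat \<Rightarrow> nat \<Rightarrow> ('w, 'a) run" where
  "boost_alg tie Alg L \<mu> lam \<delta> \<Delta>in xin T m \<omega> n =
     (let (x, n') = boost_loop tie Alg L \<mu> lam \<delta> \<Delta>in xin m (Suc T) \<omega> n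
      in alg_R tie Alg ((\<mu> + lam T) / (L + lam T) * (\<delta> / 9)) (lam T)
           (boost_Delta L \<mu> lam \<delta> T) x m \<omega> n')"

end

theory Submission
  imports Defs
begin

text \<open>
  Repeating \<open>Alg\<close> and returning a point whose ball capturing a majority of the outputs is smallest turns
  success probability \<open>2/3\<close> into \<open>1 - exp (- m/18)\<close> by Hoeffding's inequality, at the price of a
  factor 3 in the distance to the minimizer. Let \<open>z\<^sub>j\<close> be the minimizer of the proximal objective of
  stage \<open>j\<close>. Comparing the values at \<open>z\<^sub>j\<close> and \<open>z\<^sub>j\<^sub>+\<^sub>1\<close> yields
  \<open>f z\<^sub>j\<^sub>+\<^sub>1 - f z\<^sub>j \<le> \<lambda>\<^sub>j/2 * (norm (z\<^sub>j - x\<^sub>j))\<^sup>2 \<le> \<delta> * \<lambda>\<^sub>j / (\<mu> + \<lambda>\<^sub>j\<^sub>-\<^sub>1)\<close>,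
  which telescopes, and since \<open>\<lambda>\<^sub>j = \<mu> * 2 ^ j\<close> every summand is at most \<open>2 * \<delta>\<close>.
  The accuracy of the last stage is chosen so that passing from \<open>z\<^sub>j\<close> to the returned point costs only
  \<open>\<delta>\<close> there, instead of the condition number of the proximal objective times \<open>\<delta>\<close>.
\<close>

section \<open>Quadratic bounds for strongly convex and smooth functions\<close>

lemma GDERIV_along_line:
  fixes f :: "'a::real_inner \<Rightarrow> real"
  assumes "GDERIV f (x + t *\<^sub>R d) :> g"
  shows "((\<lambda>s. f (x + s *\<^sub>R d)) has_real_derivative d \<bullet> g) (at t)"
proof -
  have line: "((\<lambda>s. x + s *\<^sub>R d) has_derivative (\<lambda>s. s *\<^sub>R d)) (at t)"
    by (auto intro!: derivative_eq_intros)
  show ?thesis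
    using has_derivative_compose[OF line, of f "\<lambda>v. v \<bullet> g"] assms
    unfolding gderiv_def has_field_derivative_def mult.commute[of "d \<bullet> g", abs_def]
    by simp
qed

text \<open>Subtracting the quadratic leaves a convex function, whose restriction to the line
  through \<open>x\<close> and \<open>y\<close> lies above its tangent at parameter 0. Restoring the
  quadratic gives the bound.\<close>

lemma strongly_convex_lower_bound:
  fixes f :: "'a::euclidean_space \<Rightarrow> real"
  assumes sc: "strongly_convex \<mu> f" and g: "GDERIV f x :> g"
  shows "f x + (y - x) \<bullet> g + \<mu> / 2 * (norm (y - x))\<^sup>2 \<le> f y"
proof -
  define h where "h = (\<lambda>x. f x - \<mu> / 2 * (norm x)\<^sup>2)"
  define k where "k = (\<lambda>t::real. h (x + t *\<^sub>R (y - x)))"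
  have h: "convex_on UNIV h"
    using sc unfolding strongly_convex_def h_def .
  have aff: "x + ((1 - t) * a + t * b) *\<^sub>R d =
      (1 - t) *\<^sub>R (x + a *\<^sub>R d) + t *\<^sub>R (x + b *\<^sub>R d)" for t a b :: real and d :: 'a
    by (simp add: algebra_simps)
  have convex: "convex_on UNIV k"
  proof (rule convex_onI)
    fix t a b :: real
    assume "0 < t" "t < 1"
    then show "k ((1 - t) *\<^sub>R a + t *\<^sub>R b) \<le> (1 - t) * k a + t * k b"
      using convex_onD[OF h, of t "x + a *\<^sub>R (y - x)" "x + b *\<^sub>R (y - x)"]
      by (simp add: k_def aff)
  qed simp
  have f': "((\<lambda>t. f (x + t *\<^sub>R (y - x))) has_real_derivative (y - x) \<bullet> g) (at 0)"
    using g by (intro GDERIV_along_line) simp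
  have deriv: "(k has_real_derivative (y - x) \<bullet> g - \<mu> * (x \<bullet> (y - x))) (at 0)"
  proof -
    have "(norm (x + t *\<^sub>R (y - x)))\<^sup>2 =
        (norm x)\<^sup>2 + 2 * t * (x \<bullet> (y - x)) + t\<^sup>2 * (norm (y - x))\<^sup>2" for t
      unfolding power2_norm_eq_inner
      by (simp only: inner_add_left inner_add_right inner_scaleR_left inner_scaleR_right
          power2_eq_square inner_commute[of y x] algebra_simps)
    then show ?thesis
      unfolding k_def h_def by (auto intro!: derivative_eq_intros f')
  qed
  have "((y - x) \<bullet> g - \<mu> * (x \<bullet> (y - x))) * (1 - 0) \<le> k 1 - k 0"
    by (rule convex_on_imp_above_tangent[OF convex]) (use deriv in auto)
  moreover have "k 1 = f y - \<mu> / 2 * (norm y)\<^sup>2" "k 0 = f x - \<mu> / 2 * (norm x)\<^sup>2"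
    by (simp_all add: k_def h_def)
  moreover have "(norm y)\<^sup>2 = (norm x)\<^sup>2 + 2 * (x \<bullet> (y - x)) + (norm (y - x))\<^sup>2"
    by (simp add: power2_norm_eq_inner algebra_simps inner_commute)
  ultimately show ?thesis
    by (simp add: algebra_simps)
qed

text \<open>Along the segment, \<open>f\<close> minus its linear part and the quadratic is
  nonincreasing: Cauchy-Schwarz and the Lipschitz bound make the derivative nonpositive. This takes
  the place of integrating the gradient.\<close>

lemma lipschitz_gradient_upper_bound:
  fixes f :: "'a::euclidean_space \<Rightarrow> real"
  assumes g: "\<And>x. GDERIV f x :> g x" and lip: "L-lipschitz_on UNIV g"
  shows "f y \<le> f x + (y - x) \<bullet> g x + L / 2 * (norm (y - x))\<^sup>2"
proof -
  define d where "d = y - x"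
  define k where "k = (\<lambda>t::real. f (x + t *\<^sub>R d) - t * (d \<bullet> g x) - L / 2 * t\<^sup>2 * (norm d)\<^sup>2)"
  have deriv: "(k has_real_derivative
      d \<bullet> g (x + t *\<^sub>R d) - d \<bullet> g x - L * t * (norm d)\<^sup>2) (at t)" for t
    unfolding k_def by (auto intro!: derivative_eq_intros GDERIV_along_line[OF g])
  have "k 1 \<le> k 0"
  proof (rule DERIV_nonpos_imp_nonincreasing[of 0 1 k])
    fix t :: real
    assume t: "0 \<le> t" "t \<le> 1"
    have "d \<bullet> (g (x + t *\<^sub>R d) - g x) \<le> norm d * norm (g (x + t *\<^sub>R d) - g x)"
      by (rule norm_cauchy_schwarz)
    also have "\<dots> \<le> norm d * (L * (t * norm d))"
      using lipschitz_onD[OF lip, of "x + t *\<^sub>R d" x] t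
      by (intro mult_left_mono) (simp_all add: dist_norm)
    finally have "d \<bullet> g (x + t *\<^sub>R d) - d \<bullet> g x - L * t * (norm d)\<^sup>2 \<le> 0"
      by (simp add: inner_diff_right power2_eq_square algebra_simps)
    with deriv[of t] show "\<exists>D. DERIV k t :> D \<and> D \<le> 0"
      by blast
  qed simp
  then show ?thesis
    by (simp add: k_def d_def algebra_simps)
qed

lemma minimum_eq:
  assumes "\<And>y. g z \<le> g y"
  shows "minimum g = g z"
  unfolding minimum_def by (rule Least_equality) (use assms in auto)

lemma strongly_convex_attains_min:
  fixes f :: "'a::euclidean_space \<Rightarrow> real"
  assumes "\<mu> > 0" and sc: "strongly_convex \<mu> f" and g: "\<And>x. GDERIV f x :> g x"
  obtains z where "\<And>y. f z \<le> f y"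
proof -
  \<comment> \<open>Outside \<open>cball 0 R\<close> the quadratic term of the lower bound at 0
    outweighs the linear one, so values there are at least \<open>f 0\<close> and minimizing over
    the compact ball suffices.\<close>
  define R where "R = 2 * norm (g 0) / \<mu>"
  have cont: "continuous_on (cball 0 R) f"
    using g by (intro continuous_at_imp_continuous_on ballI)
      (auto simp: gderiv_def intro: has_derivative_continuous)
  have "R \<ge> 0"
    using \<open>\<mu> > 0\<close> by (simp add: R_def)
  then obtain z where z: "z \<in> cball 0 R" "\<And>y. y \<in> cball 0 R \<Longrightarrow> f z \<le> f y"
    using continuous_attains_inf[OF compact_cball _ cont] by auto
  have "f z \<le> f y" for y
  proof (cases "y \<in> cball 0 R")
    case False
    then have "2 * norm (g 0) < norm y * \<mu>"
      using \<open>\<mu> > 0\<close> by (simp add: R_def field_simps)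
    then have "norm y * (2 * norm (g 0)) \<le> norm y * (norm y * \<mu>)"
      by (intro mult_left_mono) auto
    moreover have "- (norm y * norm (g 0)) \<le> y \<bullet> g 0"
      using Cauchy_Schwarz_ineq2[of y "g 0"] by (simp add: abs_le_iff)
    ultimately have "f 0 \<le> f 0 + (y - 0) \<bullet> g 0 + \<mu> / 2 * (norm (y - 0))\<^sup>2"
      by (simp add: power2_eq_square algebra_simps)
    also have "\<dots> \<le> f y"
      by (rule strongly_convex_lower_bound[OF sc g])
    finally have "f 0 \<le> f y" .
    with z(2)[of 0] \<open>R \<ge> 0\<close> show ?thesis
      by simp
  qed (use z in auto)
  then show thesis
    by (rule that)
qed

text \<open>The gradient vanishes at the minimizer, so both bounds lose their linear term. They
  convert a gap in value into a squared distance and back.\<close>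

lemma strongly_convex_smooth_minimizer:
  fixes f :: "'a::euclidean_space \<Rightarrow> real"
  assumes "\<mu> > 0" and sc: "strongly_convex \<mu> f" and sm: "smooth L f"
  obtains z where "minimum f = f z"
    and "\<And>y. \<mu> / 2 * (norm (y - z))\<^sup>2 \<le> f y - f z"
    and "\<And>y. f y - f z \<le> L / 2 * (norm (y - z))\<^sup>2"
proof -
  from sm obtain g where g: "\<And>x. GDERIV f x :> g x" and lip: "L-lipschitz_on UNIV g"
    unfolding smooth_def by auto
  obtain z where z: "\<And>y. f z \<le> f y"
    using strongly_convex_attains_min[OF \<open>\<mu> > 0\<close> sc g] by auto
  have "(\<lambda>v. v \<bullet> g z) = (\<lambda>v. 0)"
    using g[of z] z by (intro differential_zero_maxmin[of z UNIV f]) (auto simp: gderiv_def)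
  then have gz: "v \<bullet> g z = 0" for v
    by meson
  show thesis
  proof (rule that)
    show "minimum f = f z"
      using z by (rule minimum_eq)
    show "\<mu> / 2 * (norm (y - z))\<^sup>2 \<le> f y - f z" for y
      using strongly_convex_lower_bound[OF sc g, of z y] by (simp add: gz)
    show "f y - f z \<le> L / 2 * (norm (y - z))\<^sup>2" for y
      using lipschitz_gradient_upper_bound[OF g lip, of y z] by (simp add: gz)
  qed
qed

lemma strongly_convex_smooth_le:
  fixes f :: "'a::euclidean_space \<Rightarrow> real"
  assumes "\<mu> > 0" "strongly_convex \<mu> f" "smooth L f"
  shows "\<mu> \<le> L"
proof -
  obtain z where z: "\<And>y. \<mu> / 2 * (norm (y - z))\<^sup>2 \<le> f y - f z"
    "\<And>y. f y - f z \<le> L / 2 * (norm (y - z))\<^sup>2"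
    using strongly_convex_smooth_minimizer[OF assms] by metis
  obtain b :: 'a where b: "b \<in> Basis"
    using nonempty_Basis by blast
  \<comment> \<open>At unit distance from \<open>z\<close> the two bounds read
    \<open>\<mu> / 2\<close> and \<open>L / 2\<close>.\<close>
  show ?thesis
    using order_trans[OF z[of "z + b"]] b by simp
qed

section \<open>Convexity and smoothness of the proximal objective\<close>

lemma strongly_convex_prox_obj:
  assumes "strongly_convex \<mu> f" 
  shows "strongly_convex (\<mu> + lam) (prox_obj f lam x)"
proof -
  \<comment> \<open>What remains of the penalty after removing
    \<open>lam / 2 * (norm y)\<^sup>2\<close> is affine in \<open>y\<close>, hence convex.\<close>
  define c where "c = lam / 2 * (norm x)\<^sup>2"
  define a where "a = (\<lambda>y. c - lam * (y \<bullet> x))"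
  have "convex_on UNIV a"
    unfolding a_def by (rule convex_onI) (simp_all add: inner_add_left algebra_simps)
  then have "convex_on UNIV (\<lambda>y. (f y - \<mu> / 2 * (norm y)\<^sup>2) + a y)"
    using assms unfolding strongly_convex_def by (intro convex_on_add)
  also have "(\<lambda>y. (f y - \<mu> / 2 * (norm y)\<^sup>2) + a y) =
      (\<lambda>y. prox_obj f lam x y - (\<mu> + lam) / 2 * (norm y)\<^sup>2)"
    by (simp add: a_def c_def prox_obj_def power2_norm_eq_inner inner_commute
        inner_diff_left inner_diff_right field_simps)
  finally show ?thesis
    unfolding strongly_convex_def .
qed

lemma smooth_prox_obj:
  assumes "smooth L f" "lam \<ge> 0"
  shows "smooth (L + lam) (prox_obj f lam x)"
proof -
  from assms obtain g where g: "\<And>x. GDERIV f x :> g x" and lip: "L-lipschitz_on UNIV g"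
    unfolding smooth_def by auto
  have "GDERIV (prox_obj f lam x) y :> g y + lam *\<^sub>R (y - x)" for y
    using g[of y] unfolding gderiv_def prox_obj_def power2_norm_eq_inner
    by (auto intro!: derivative_eq_intros simp: algebra_simps inner_commute)
  moreover have "(L + lam)-lipschitz_on UNIV (\<lambda>y. g y + lam *\<^sub>R (y - x))"
  proof (rule lipschitz_on_add[OF lip])
    have "1-lipschitz_on UNIV (\<lambda>y. y - x)"
      by (simp add: lipschitz_on_def dist_norm)
    then show "lam-lipschitz_on UNIV (\<lambda>y. lam *\<^sub>R (y - x))"
      using lipschitz_on_cmult_nonneg[OF _ \<open>lam \<ge> 0\<close>] by fastforce
  qed
  ultimately show ?thesis
    unfolding smooth_def by (intro exI conjI allI)
qed

lemma continuous_on_smooth: "smooth L f \<Longrightarrow> continuous_on A f"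
  unfolding smooth_def gderiv_def
  by (meson continuous_at_imp_continuous_on has_derivative_continuous)

section \<open>Majority radii and the selected point\<close>

lemma repeat_alg_eq:
  "repeat_alg Alg \<delta> lam \<Delta> x m \<omega> n = (map (\<lambda>k. Alg \<delta> lam \<Delta> x (\<omega> (n + k))) [0..<m], n + m)"
  by (induction m) (auto simp: call_alg_def)

text \<open>Counts in this form are measurable as finite sums and match the sums in Hoeffding's
  inequality.\<close>

lemma real_card_eq_sum:
  fixes m :: nat
  shows "real (card {k. k < m \<and> P k}) = (\<Sum>k<m. if P k then 1 else 0)"
proof -
  have "(\<Sum>k<m. if P k then 1 else (0 :: real)) = (\<Sum>k\<in>{k \<in> {..<m}. P k}. 1)"
    by (rule sum.inter_filter[symmetric]) simp
  then show ?thesis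
    by simp
qed

text \<open>The number of points in a ball around \<open>ys ! i\<close> changes only at the finitely
  many distances in \<open>D\<close>. Hence the \<open>LEAST\<close> over the reals is attained, at
  the least such distance whose ball holds a majority.\<close>

lemma majority_radius_le_iff:
  assumes "ys \<noteq> []"
  shows "majority_radius ys i \<le> r \<longleftrightarrow>
    real (card {k. k < length ys \<and> norm (ys ! k - ys ! i) \<le> r}) > real (length ys) / 2"
proof -
  define C where "C = (\<lambda>r. {k. k < length ys \<and> norm (ys ! k - ys ! i) \<le> r})"
  define Q where "Q = {r. r \<ge> 0 \<and> real (card (C r)) > real (length ys) / 2}"
  define D where "D = (\<lambda>k. norm (ys ! k - ys ! i)) ` {..<length ys}"
  have D: "finite D" "D \<noteq> {}"
    using assms by (auto simp: D_def)
  have Q_iff: "r \<in> Q \<longleftrightarrow> real (card (C r)) > real (length ys) / 2" for r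
  proof -
    \<comment> \<open>A majority is nonempty, and a norm bounded by \<open>r\<close> forces
      \<open>r\<close> to be nonnegative.\<close>
    have "r \<ge> 0" if "real (card (C r)) > real (length ys) / 2"
    proof -
      from that have "C r \<noteq> {}"
        by auto
      then show ?thesis
        unfolding C_def using norm_ge_zero order_trans by blast
    qed
    then show ?thesis
      by (auto simp: Q_def)
  qed
  have below: "\<exists>d\<in>D \<inter> Q. d \<le> r" if "r \<in> Q" for r
  proof -
    \<comment> \<open>Rounding \<open>r\<close> down to the largest distance not exceeding it keeps
      every point of the ball.\<close>
    define D' where "D' = {d \<in> D. d \<le> r}"
    have "C r \<noteq> {}"
      using that by (auto simp: Q_iff)
    then have D': "finite D'" "D' \<noteq> {}"
      using D by (auto simp: D'_def D_def C_def)
    then have max: "Max D' \<in> D" "Max D' \<le> r"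
      using Max_in[OF D'] by (auto simp: D'_def)
    have "norm (ys ! k - ys ! i) \<le> Max D'" if "k < length ys" "norm (ys ! k - ys ! i) \<le> r" for k
      using D'(1) that by (intro Max_ge) (auto simp: D'_def D_def)
    then have "C r = C (Max D')"
      unfolding C_def using order_trans[OF _ max(2)] by auto
    with max that show ?thesis
      by (auto simp: Q_iff)
  qed
  have "C (Max D) = {..<length ys}"
    using D by (auto simp: C_def D_def intro: Max_ge)
  then have "Max D \<in> Q"
    using assms by (simp add: Q_iff)
  then have DQ: "finite (D \<inter> Q)" "D \<inter> Q \<noteq> {}"
    using D Max_in[OF D] \<open>Max D \<in> Q\<close> by blast+
  have "majority_radius ys i = (LEAST r. r \<in> Q)"
    by (simp add: majority_radius_def Q_def C_def)
  also have "\<dots> = Min (D \<inter> Q)"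
  proof (rule Least_equality)
    show "Min (D \<inter> Q) \<in> Q"
      using Min_in[OF DQ] by blast
    show "Min (D \<inter> Q) \<le> r" if "r \<in> Q" for r
      using below[OF that] DQ by (meson Min_le order_trans)
  qed
  finally have eq: "majority_radius ys i = Min (D \<inter> Q)" .
  have "majority_radius ys i \<le> r \<longleftrightarrow> r \<in> Q"
  proof
    assume "majority_radius ys i \<le> r"
    then have "C (Min (D \<inter> Q)) \<subseteq> C r"
      by (auto simp: C_def eq)
    then have "card (C (Min (D \<inter> Q))) \<le> card (C r)"
      by (intro card_mono) (auto simp: C_def)
    moreover have "Min (D \<inter> Q) \<in> Q"
      using Min_in[OF DQ] by blast
    ultimately show "r \<in> Q"
      by (auto simp: Q_iff)
  next
    assume "r \<in> Q"
    then show "majority_radius ys i \<le> r"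
      unfolding eq using below DQ by (meson Min_le order_trans)
  qed
  then show ?thesis
    by (simp add: Q_iff C_def)
qed

lemma radius_minimizers_nonempty:
  assumes "ys \<noteq> []"
  shows "radius_minimizers ys \<noteq> {}"
proof -
  have "Min (majority_radius ys ` {..<length ys}) \<in> majority_radius ys ` {..<length ys}"
    using assms by (intro Min_in) auto
  then obtain i where "i < length ys" "majority_radius ys i = Min (majority_radius ys ` {..<length ys})"
    by auto
  then have "i \<in> radius_minimizers ys"
    by (auto simp: radius_minimizers_def)
  then show ?thesis
    by auto
qed

lemma majorities_intersect:
  assumes "real (card {k. k < n \<and> P k}) > real n / 2" "real (card {k. k < n \<and> Q k}) > real n / 2"
  shows "\<exists>k<n. P k \<and> Q k"
proof (rule ccontr)
  assume "\<not> (\<exists>k<n. P k \<and> Q k)"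
  then have "card {k. k < n \<and> P k} + card {k. k < n \<and> Q k} =
      card ({k. k < n \<and> P k} \<union> {k. k < n \<and> Q k})"
    by (intro card_Un_disjoint[symmetric]) auto
  also have "\<dots> \<le> card {..<n}"
    by (intro card_mono) auto
  finally show False
    using assms by simp
qed

text \<open>Points within \<open>r\<close> of \<open>z\<close> are pairwise within
  \<open>2 * r\<close>, so the radius of any of them, and thus the minimal radius, is at most
  \<open>2 * r\<close>. The majority around the selected point meets the majority around
  \<open>z\<close>, and a common point gives \<open>2 * r + r\<close>.\<close>

lemma radius_minimizer_close:
  assumes i: "i \<in> radius_minimizers ys"
    and G: "real (card {k. k < length ys \<and> norm (ys ! k - z) \<le> r}) > real (length ys) / 2"
  shows "norm (ys ! i - z) \<le> 3 * r"
proof -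
  have "ys \<noteq> []"
    using i by (auto simp: radius_minimizers_def)
  note le_iff = majority_radius_le_iff[OF this]
  obtain k where k: "k < length ys" "norm (ys ! k - z) \<le> r"
    using majorities_intersect[OF G G] by auto
  have "norm (ys ! l - ys ! k) \<le> 2 * r" if "norm (ys ! l - z) \<le> r" for l
    using norm_triangle_ineq4[of "ys ! l - z" "ys ! k - z"] that k by simp
  then have "card {l. l < length ys \<and> norm (ys ! l - z) \<le> r} \<le>
      card {l. l < length ys \<and> norm (ys ! l - ys ! k) \<le> 2 * r}"
    by (intro card_mono) auto
  then have "majority_radius ys k \<le> 2 * r"
    unfolding le_iff using G by linarith
  then have "majority_radius ys i \<le> 2 * r"
    using i k by (force simp: radius_minimizers_def)
  from majorities_intersect[OF G this[unfolded le_iff]]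
  obtain l where "norm (ys ! l - z) \<le> r" "norm (ys ! l - ys ! i) \<le> 2 * r"
    by auto
  then show ?thesis
    using norm_triangle_ineq4[of "ys ! l - z" "ys ! l - ys ! i"] by simp
qed

section \<open>Measurability of the selection\<close>

lemma measurable_majority_radius:
  fixes Y :: "'c \<Rightarrow> nat \<Rightarrow> 'a::euclidean_space"
  assumes [measurable]: "\<And>k. (\<lambda>p. Y p k) \<in> borel_measurable N" and "i < m"
  shows "(\<lambda>p. majority_radius (map (Y p) [0..<m]) i) \<in> borel_measurable N"
  unfolding borel_measurable_iff_le
proof
  fix a
  have "map (Y p) [0..<m] \<noteq> []" for p
    using \<open>i < m\<close> by simp
  \<comment> \<open>Sublevel sets suffice, and each becomes a threshold on a finite sum of
    indicators.\<close>
  from majority_radius_le_iff[OF this]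
  have "majority_radius (map (Y p) [0..<m]) i \<le> a \<longleftrightarrow>
      real (card {k. k < m \<and> norm (Y p k - Y p i) \<le> a}) > real m / 2" for p
    using \<open>i < m\<close> by (simp cong: conj_cong)
  then have eq: "{p \<in> space N. majority_radius (map (Y p) [0..<m]) i \<le> a} =
      {p \<in> space N. (\<Sum>k<m. if norm (Y p k - Y p i) \<le> a then 1 else 0) > real m / 2}"
    by (simp add: real_card_eq_sum)
  show "{p \<in> space N. majority_radius (map (Y p) [0..<m]) i \<le> a} \<in> sets N"
    unfolding eq by measurable
qed

text \<open>There are finitely many possible values, and each preimage is a finite Boolean
  combination of comparisons of radii. The empty set is excluded from the target so that
  \<open>tie\<close> is only applied where it returns an element.\<close>

lemma measurable_radius_minimizers:
  fixes Y :: "'c \<Rightarrow> nat \<Rightarrow> 'a::euclidean_space"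
  assumes Y [measurable]: "\<And>k. (\<lambda>p. Y p k) \<in> borel_measurable N" and "m > 0"
  shows "(\<lambda>p. radius_minimizers (map (Y p) [0..<m])) \<in> N \<rightarrow>\<^sub>M count_space (Pow {..<m} - {{}})"
proof -
  have "(\<lambda>p. radius_minimizers (map (Y p) [0..<m])) -` {I} \<inter> space N \<in> sets N"
    if "I \<subseteq> {..<m}" for I
  proof -
    define R where "R = (\<lambda>p. majority_radius (map (Y p) [0..<m]))"
    have [measurable]: "(\<lambda>p. R p i) \<in> borel_measurable N" if "i \<in> {..<m}" for i
      using measurable_majority_radius[OF Y] that by (simp add: R_def)
    have "(\<lambda>p. radius_minimizers (map (Y p) [0..<m])) -` {I} \<inter> space N =
      {p \<in> space N. \<forall>i\<in>{..<m}. i \<in> I \<longleftrightarrow> (\<forall>k\<in>{..<m}. R p i \<le> R p k)}"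
      using that by (auto simp: radius_minimizers_def R_def subset_iff set_eq_iff)
    also have "\<dots> \<in> sets N"
      by measurable
    finally show ?thesis .
  qed
  moreover have "radius_minimizers (map (Y p) [0..<m]) \<noteq> {}" for p
    using \<open>m > 0\<close> by (intro radius_minimizers_nonempty) simp
  moreover have "radius_minimizers (map (Y p) [0..<m]) \<subseteq> {..<m}" for p
    by (auto simp: radius_minimizers_def)
  ultimately show ?thesis
    by (subst measurable_count_space_eq2) auto
qed

text \<open>For each fixed value \<open>I\<close> of the minimizer set the selected index is the
  constant \<open>tie I\<close>, so the selection is pieced together from countably many measurable
  maps.\<close>

lemma measurable_select_radius_minimizer:
  fixes Y :: "'c \<Rightarrow> nat \<Rightarrow> 'a::euclidean_space"
  assumes Y [measurable]: "\<And>k. (\<lambda>p. Y p k) \<in> borel_measurable N" and "m > 0"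
    and tie: "\<And>I. finite I \<Longrightarrow> I \<noteq> {} \<Longrightarrow> tie I \<in> I"
  shows "(\<lambda>p. map (Y p) [0..<m] ! tie (radius_minimizers (map (Y p) [0..<m]))) \<in> borel_measurable N"
proof (rule measurable_compose_countable'[OF _ measurable_radius_minimizers[OF Y \<open>m > 0\<close>]])
  fix I assume I: "I \<in> Pow {..<m} - {{}}"
  then have "finite I" "I \<noteq> {}"
    by (auto intro: finite_subset[of I "{..<m}"])
  from tie[OF this] I have "tie I < m"
    by auto
  then show "(\<lambda>p. map (Y p) [0..<m] ! tie I) \<in> borel_measurable N"
    by simp
qed (auto intro: countable_finite)

section \<open>Concentration of the number of good seeds\<close>

lemma indep_vars_PiM_coordinates:
  assumes "prob_space S"
  shows "prob_space.indep_vars (\<Pi>\<^sub>M i\<in>(UNIV :: nat set). S) (\<lambda>_. S) (\<lambda>k \<omega>. \<omega> k) UNIV"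
proof -
  interpret prob_space S by fact
  interpret P: prob_space "\<Pi>\<^sub>M i\<in>(UNIV :: nat set). S"
    by (intro prob_space_PiM) (rule prob_space_axioms)
  have "distr (\<Pi>\<^sub>M i\<in>(UNIV :: nat set). S) S (\<lambda>\<omega>. \<omega> k) = S" for k
    by (rule distr_PiM_component) (auto intro: prob_space_axioms)
  then show ?thesis
    by (subst P.indep_vars_iff_distr_eq_PiM) (auto simp: restrict_UNIV)
qed

text \<open>The count is a sum of independent indicators with mean at least
  \<open>2 * m / 3\<close>, so falling to \<open>m / 2\<close> is a deviation of at least
  \<open>m / 6\<close>. Hoeffding's exponent \<open>2 * (m / 6)\<^sup>2 / m\<close> equals
  \<open>m / 18\<close>, the source of the 18 in the choice of \<open>m\<close>.\<close>

lemma prob_majority_ge: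
  fixes m :: nat
  assumes "prob_space S" and G [measurable]: "G \<in> sets S" and ge: "measure S G \<ge> 2 / 3" and "m > 0"
  shows "measure (\<Pi>\<^sub>M i\<in>(UNIV :: nat set). S)
      {\<omega> \<in> space (\<Pi>\<^sub>M i\<in>(UNIV :: nat set). S). real (card {k. k < m \<and> \<omega> k \<in> G}) > real m / 2}
    \<ge> 1 - exp (- real m / 18)"
proof -
  let ?P = "\<Pi>\<^sub>M i\<in>(UNIV :: nat set). S"
  define X :: "nat \<Rightarrow> (nat \<Rightarrow> 'a) \<Rightarrow> real" where "X = (\<lambda>k \<omega>. indicator G (\<omega> k))"
  interpret S: prob_space S by fact
  interpret P: prob_space ?P
    by (intro prob_space_PiM assms)
  have distr: "distr ?P S (\<lambda>\<omega>. \<omega> k) = S" for k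
    by (rule distr_PiM_component) (auto intro: assms)
  have expect: "P.expectation (X k) = measure S G" for k
  proof -
    have "P.expectation (X k) = integral\<^sup>L (distr ?P S (\<lambda>\<omega>. \<omega> k)) (indicator G)"
      unfolding X_def by (rule integral_distr[symmetric]) measurable
    then show ?thesis
      by (simp add: distr)
  qed
  have "P.indep_vars (\<lambda>_. borel) X {..<m}"
    unfolding X_def
    by (rule P.indep_vars_compose2[OF
          P.indep_vars_subset[OF indep_vars_PiM_coordinates[OF assms(1)]]]) auto
  then interpret Hoeffding_ineq ?P "{..<m}" X "\<lambda>_. 0" "\<lambda>_. 1" "\<Sum>k<m. P.expectation (X k)"
    by unfold_locales (auto simp: X_def)
  \<comment> \<open>Measured from the actual mean, this deviation puts the tail threshold exactly at
    \<open>m / 2\<close>.\<close>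
  define \<epsilon> where "\<epsilon> = real m * measure S G - real m / 2"
  have eps: "\<epsilon> \<ge> real m / 6"
    using mult_left_mono[OF ge, of "real m"] by (simp add: \<epsilon>_def)
  have sum: "(\<Sum>k<m. X k \<omega>) = real (card {k. k < m \<and> \<omega> k \<in> G})" for \<omega>
    by (simp only: X_def real_card_eq_sum indicator_def of_bool_def)
  have "P.prob {\<omega> \<in> space ?P. (\<Sum>k<m. X k \<omega>) \<le> (\<Sum>k<m. P.expectation (X k)) - \<epsilon>} \<le>
      exp (- 2 * \<epsilon>\<^sup>2 / (\<Sum>k<m. (1 - 0)\<^sup>2))"
    by (rule Hoeffding_ineq_le) (use \<open>m > 0\<close> eps in auto)
  also have "\<dots> \<le> exp (- real m / 18)"
  proof -
    have "(real m / 6)\<^sup>2 \<le> \<epsilon>\<^sup>2"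
      using eps by (intro power_mono) auto
    then show ?thesis
      using \<open>m > 0\<close> by (simp add: field_simps power2_eq_square)
  qed
  finally have tail: "P.prob {\<omega> \<in> space ?P. (\<Sum>k<m. X k \<omega>) \<le> real m / 2} \<le> exp (- real m / 18)"
    by (simp add: expect \<epsilon>_def)
  have "P.prob {\<omega> \<in> space ?P. \<not> (\<Sum>k<m. X k \<omega>) \<le> real m / 2} =
      1 - P.prob {\<omega> \<in> space ?P. (\<Sum>k<m. X k \<omega>) \<le> real m / 2}"
    by (rule P.prob_neg) (simp add: X_def)
  with tail show ?thesis
    by (simp add: sum not_le)
qed

section \<open>Call counts, seed blocks and independence of successive stages\<close>

lemma alg_R_eq:
  "alg_R tie Alg \<delta> lam \<Delta> x m \<omega> n =
    (let ys = map (\<lambda>k. Alg \<delta> lam \<Delta> x (\<omega> (n + k))) [0..<m] in (ys ! tie (radius_minimizers ys), n + m))"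
  by (simp add: alg_R_def repeat_alg_eq Let_def)

lemma snd_alg_R: "snd (alg_R tie Alg \<delta> lam \<Delta> x m \<omega> n) = n + m"
  by (simp add: alg_R_eq Let_def)

lemma fst_alg_R_shift:
  "fst (alg_R tie Alg \<delta> lam \<Delta> x m \<omega> n) = fst (alg_R tie Alg \<delta> lam \<Delta> x m (\<lambda>k. \<omega> (n + k)) 0)"
  by (simp add: alg_R_eq Let_def)

lemma snd_boost_loop: "snd (boost_loop tie Alg L \<mu> lam \<delta> \<Delta>in xin m j \<omega> n) = n + j * m"
  by (induction j) (auto simp: case_prod_unfold snd_alg_R)

lemma snd_boost_alg: "snd (boost_alg tie Alg L \<mu> lam \<delta> \<Delta>in xin T m \<omega> n) = n + (T + 2) * m"
  by (simp add: boost_alg_def case_prod_unfold snd_alg_R snd_boost_loop del: boost_loop.simps)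

text \<open>Earlier stages consume exactly \<open>j * m\<close> seeds, whatever their values. A
  stage is therefore a run from counter 0 on the shifted sequence, the shape that
  \<open>prob_fresh_step_ge\<close> treats.\<close>

lemma fst_boost_loop_Suc:
  "fst (boost_loop tie Alg L \<mu> lam \<delta> \<Delta>in xin m (Suc j) \<omega> 0) =
    fst (alg_R tie Alg (\<delta> / 9) (case_nat 0 lam j) (case_nat \<Delta>in (boost_Delta L \<mu> lam \<delta>) j)
      (fst (boost_loop tie Alg L \<mu> lam \<delta> \<Delta>in xin m j \<omega> 0)) m (\<lambda>k. \<omega> (j * m + k)) 0)"
  by (simp add: case_prod_unfold snd_boost_loop fst_alg_R_shift[of _ _ _ _ _ _ _ _ "j * m"])

lemma fst_boost_alg:
  "fst (boost_alg tie Alg L \<mu> lam \<delta> \<Delta>in xin T m \<omega> 0) =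
    fst (alg_R tie Alg ((\<mu> + lam T) / (L + lam T) * (\<delta> / 9)) (lam T) (boost_Delta L \<mu> lam \<delta> T)
      (fst (boost_loop tie Alg L \<mu> lam \<delta> \<Delta>in xin m (Suc T) \<omega> 0)) m (\<lambda>k. \<omega> (Suc T * m + k)) 0)"
  unfolding boost_alg_def Let_def case_prod_unfold snd_boost_loop
  by (subst fst_alg_R_shift) (simp del: boost_loop.simps)

text \<open>Provides the hypothesis \<open>past\<close> of \<open>prob_fresh_step_ge\<close>: the
  seeds of later stages are fresh.\<close>

lemma boost_loop_cong:
  fixes Alg :: "('a::euclidean_space, 'w) proc"
  assumes "\<And>k. k < j * m \<Longrightarrow> \<omega> k = \<omega>' k"
  shows "fst (boost_loop tie Alg L \<mu> lam \<delta> \<Delta>in xin m j \<omega> 0) =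
    fst (boost_loop tie Alg L \<mu> lam \<delta> \<Delta>in xin m j \<omega>' 0)"
  using assms
proof (induction j)
  case (Suc j)
  have IH: "fst (boost_loop tie Alg L \<mu> lam \<delta> \<Delta>in xin m j \<omega> 0) =
      fst (boost_loop tie Alg L \<mu> lam \<delta> \<Delta>in xin m j \<omega>' 0)"
    using Suc by simp
  have seeds: "map (\<lambda>k. A (\<omega> (j * m + k))) [0..<m] = map (\<lambda>k. A (\<omega>' (j * m + k))) [0..<m]"
    for A :: "'w \<Rightarrow> 'a"
    using Suc.prems by (intro map_cong) auto
  show ?case
    by (simp only: fst_boost_loop_Suc alg_R_eq Let_def fst_conv add_0 IH seeds)
qed simp

text \<open>Gluing the first \<open>n\<close> seeds of one sequence to a second, independent
  sequence reproduces the law \<open>P\<close>. After gluing, \<open>X\<close> sees only the first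
  sequence and the shifted seeds are the second, so Fubini reduces the claim to success
  probabilities at fixed inputs.\<close>

lemma prob_fresh_step_ge:
  fixes S :: "'w measure" and X :: "(nat \<Rightarrow> 'w) \<Rightarrow> 'a::topological_space"
    and R :: "'a \<Rightarrow> (nat \<Rightarrow> 'w) \<Rightarrow> 'b::topological_space"
  defines "P \<equiv> \<Pi>\<^sub>M i\<in>(UNIV :: nat set). S"
  assumes S: "prob_space S"
    and X [measurable]: "X \<in> P \<rightarrow>\<^sub>M borel"
    and past: "\<And>\<omega> \<omega>'. (\<And>k. k < n \<Longrightarrow> \<omega> k = \<omega>' k) \<Longrightarrow> X \<omega> = X \<omega>'"
    and R [measurable]: "(\<lambda>(x, \<omega>). R x \<omega>) \<in> borel \<Otimes>\<^sub>M P \<rightarrow>\<^sub>M borel"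
    and [measurable]: "K \<in> sets borel" "K' \<in> sets borel"
    and a: "measure P {\<omega> \<in> space P. X \<omega> \<in> K} \<ge> a"
    and b: "\<And>x. x \<in> K \<Longrightarrow> measure P {\<omega> \<in> space P. R x \<omega> \<in> K'} \<ge> b" "b \<ge> 0"
  shows "measure P {\<omega> \<in> space P. R (X \<omega>) (\<lambda>k. \<omega> (n + k)) \<in> K'} \<ge> a * b"
proof -
  interpret S: prob_space S by (rule S)
  interpret sequence_space S ..
  interpret PS: prob_space P
    unfolding P_def by (intro prob_space_PiM S)
  define E where "E = {\<omega> \<in> space P. R (X \<omega>) (\<lambda>k. \<omega> (n + k)) \<in> K'}"
  define F where "F = {\<omega> \<in> space P. X \<omega> \<in> K}"
  have F [measurable]: "F \<in> sets P"
    unfolding F_def by measurable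
  have shift [measurable]: "(\<lambda>\<omega> k. \<omega> (n + k)) \<in> P \<rightarrow>\<^sub>M P"
    unfolding P_def by (rule measurable_PiM_single') (auto simp: space_PiM)
  have E [measurable]: "E \<in> sets P"
    unfolding E_def by measurable
  have comb: "X (comb_seq n \<omega> \<omega>') = X \<omega>" "(\<lambda>k. comb_seq n \<omega> \<omega>' (n + k)) = \<omega>'" for \<omega> \<omega>'
    by (auto intro!: past simp: comb_seq_def)
  have meas_comb: "(\<lambda>(\<omega>, \<omega>'). comb_seq n \<omega> \<omega>') \<in> P \<Otimes>\<^sub>M P \<rightarrow>\<^sub>M P"
    unfolding P_def by (rule measurable_comb_seq)
  have "emeasure P E = emeasure (distr (P \<Otimes>\<^sub>M P) P (\<lambda>(\<omega>, \<omega>'). comb_seq n \<omega> \<omega>')) E"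
    unfolding P_def PiM_comb_seq ..
  also have "\<dots> = emeasure (P \<Otimes>\<^sub>M P) ((\<lambda>(\<omega>, \<omega>'). comb_seq n \<omega> \<omega>') -` E \<inter> space (P \<Otimes>\<^sub>M P))"
    by (rule emeasure_distr[OF meas_comb E])
  also have "(\<lambda>(\<omega>, \<omega>'). comb_seq n \<omega> \<omega>') -` E \<inter> space (P \<Otimes>\<^sub>M P) =
      {p \<in> space (P \<Otimes>\<^sub>M P). R (X (fst p)) (snd p) \<in> K'}"
    using measurable_space[OF meas_comb] by (force simp: E_def comb)
  also have "emeasure (P \<Otimes>\<^sub>M P) \<dots> = (\<integral>\<^sup>+ \<omega>. emeasure P (Pair \<omega> -` \<dots>) \<partial>P)"
    by (rule PS.emeasure_pair_measure_alt) measurable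
  also have "\<dots> = (\<integral>\<^sup>+ \<omega>. ennreal (measure P {\<omega>' \<in> space P. R (X \<omega>) \<omega>' \<in> K'}) \<partial>P)"
    by (intro nn_integral_cong)
      (auto simp: PS.emeasure_eq_measure space_pair_measure intro!: arg_cong[where f = "measure P"])
  finally have eq: "emeasure P E = \<dots>" .
  \<comment> \<open>The integrand is at least \<open>b\<close> on \<open>F\<close> and at least 0
    elsewhere.\<close>
  have "ennreal (b * measure P F) = ennreal b * emeasure P F"
    using b by (simp add: PS.emeasure_eq_measure ennreal_mult)
  also have "\<dots> = (\<integral>\<^sup>+ \<omega>. ennreal b * indicator F \<omega> \<partial>P)"
    by (simp add: nn_integral_cmult_indicator)
  also have "\<dots> \<le> emeasure P E"
    unfolding eq using b by (intro nn_integral_mono) (auto simp: F_def indicator_def intro!: ennreal_leI)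
  finally have "b * measure P F \<le> measure P E"
    by (simp add: PS.emeasure_eq_measure ennreal_le_iff)
  moreover have "b * a \<le> b * measure P F"
    using a b by (intro mult_left_mono) (simp_all add: F_def)
  ultimately show ?thesis
    by (simp add: E_def mult.commute)
qed

section \<open>Accuracy of one stage and the invariant set\<close>

locale boost_setting =
  fixes f :: "'a::euclidean_space \<Rightarrow> real" and Alg :: "('a, 'w) proc" and S :: "'w measure"
    and tie :: "nat set \<Rightarrow> nat" and \<mu> L :: real and m :: nat
  assumes mu_pos: "\<mu> > 0" and sc: "strongly_convex \<mu> f" and sm: "smooth L f"
    and alg: "is_alg f S Alg"
    and tie: "\<And>I. finite I \<Longrightarrow> I \<noteq> {} \<Longrightarrow> tie I \<in> I"
    and m_pos: "m > 0"
begin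

abbreviation P :: "(nat \<Rightarrow> 'w) measure" where
  "P \<equiv> \<Pi>\<^sub>M i\<in>(UNIV :: nat set). S"

lemma prob_space_seed: "prob_space S"
  using alg by (simp add: is_alg_def)

sublocale P: prob_space P
  by (intro prob_space_PiM prob_space_seed)

lemma mu_le_L: "\<mu> \<le> L"
  using strongly_convex_smooth_le mu_pos sc sm by blast

lemma measurable_f [measurable]: "f \<in> borel_measurable borel"
  using continuous_on_smooth[OF sm] by (rule borel_measurable_continuous_onI)

lemma measurable_Alg:
  assumes "\<delta> > 0" "lam \<ge> 0" "\<Delta> > 0"
  shows "(\<lambda>(x, w). Alg \<delta> lam \<Delta> x w) \<in> borel \<Otimes>\<^sub>M S \<rightarrow>\<^sub>M borel"
  using alg assms unfolding is_alg_def by blast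

text \<open>Measurability is joint in point and seeds because the input of a stage is the random
  output of the previous one.\<close>

lemma measurable_alg_R:
  assumes "\<delta> > 0" "lam \<ge> 0" "\<Delta> > 0"
  shows "(\<lambda>(x, \<omega>). fst (alg_R tie Alg \<delta> lam \<Delta> x m \<omega> 0)) \<in> borel \<Otimes>\<^sub>M P \<rightarrow>\<^sub>M borel"
proof -
  have "(\<lambda>p. Alg \<delta> lam \<Delta> (fst p) (snd p k)) \<in> borel \<Otimes>\<^sub>M P \<rightarrow>\<^sub>M borel" for k
  proof -
    have "(\<lambda>p :: 'a \<times> (nat \<Rightarrow> 'w). (fst p, snd p k)) \<in> borel \<Otimes>\<^sub>M P \<rightarrow>\<^sub>M borel \<Otimes>\<^sub>M S"
      by measurable
    from measurable_compose[OF this measurable_Alg[OF assms]] show ?thesis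
      by simp
  qed
  from measurable_select_radius_minimizer[OF this m_pos tie]
  show ?thesis
    by (simp add: alg_R_eq Let_def case_prod_unfold)
qed

text \<open>Here \<open>z'\<close> is the minimizer of the proximal objective. Strong convexity
  turns accuracy \<open>\<delta>\<close> into squared distance
  \<open>2 * \<delta> / (\<mu> + lam)\<close>, selection multiplies this by
  \<open>3\<^sup>2\<close>, and smoothness converts it back into a value. The test point
  \<open>z\<close> controls the offset \<open>a\<close>, since \<open>z'\<close> does at least as
  well and \<open>f\<close> lies below the proximal objective.\<close>

lemma alg_R_accuracy:
  assumes "\<delta> > 0" "lam \<ge> 0" "\<Delta> > 0" and gap: "f x - minimum f \<le> \<Delta>"
    and z: "prox_obj f lam x z - minimum f \<le> a"
  obtains z' where "f z' - minimum f \<le> a"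
    and "\<And>y. (norm (y - z'))\<^sup>2 \<le> 18 * \<delta> / (\<mu> + lam) \<Longrightarrow>
      f y - minimum f \<le> 9 * \<delta> * ((L + lam) / (\<mu> + lam)) + a"
    and "measure P {\<omega> \<in> space P.
      (norm (fst (alg_R tie Alg \<delta> lam \<Delta> x m \<omega> 0) - z'))\<^sup>2 \<le> 18 * \<delta> / (\<mu> + lam)}
      \<ge> 1 - exp (- real m / 18)"
proof -
  let ?\<phi> = "prox_obj f lam x"
  have c: "\<mu> + lam > 0"
    using mu_pos \<open>lam \<ge> 0\<close> by simp
  from strongly_convex_smooth_minimizer[OF c strongly_convex_prox_obj[OF sc, of lam x]
      smooth_prox_obj[OF sm \<open>lam \<ge> 0\<close>, of x]]
  obtain z' where min: "minimum ?\<phi> = ?\<phi> z'"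
    and lower: "\<And>y. (\<mu> + lam) / 2 * (norm (y - z'))\<^sup>2 \<le> ?\<phi> y - ?\<phi> z'"
    and upper: "\<And>y. ?\<phi> y - ?\<phi> z' \<le> (L + lam) / 2 * (norm (y - z'))\<^sup>2"
    by metis
  obtain z0 where z0: "minimum f = f z0" "\<And>y. \<mu> / 2 * (norm (y - z0))\<^sup>2 \<le> f y - f z0"
    using strongly_convex_smooth_minimizer[OF mu_pos sc sm] by metis
  have f_min: "minimum f \<le> f y" for y
    using order_trans[OF _ z0(2)[of y], of 0] mu_pos z0(1) by simp
  have f_le: "f y \<le> ?\<phi> y" for y
    using \<open>lam \<ge> 0\<close> by (simp add: prox_obj_def)
  have opt: "?\<phi> z' \<le> ?\<phi> y" for y
    using order_trans[OF _ lower[of y], of 0] c by simp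
  have near_opt: "?\<phi> z' - minimum f \<le> a"
    using opt[of z] z by linarith
  \<comment> \<open>The penalty vanishes at \<open>x\<close> and is nonnegative elsewhere, so the
    proximal gap at \<open>x\<close> is at most the gap of \<open>f\<close>.\<close>
  have "?\<phi> x - minimum ?\<phi> \<le> \<Delta>"
    using gap f_min[of z'] f_le[of z'] min by (simp add: prox_obj_def)
  define G where "G = {w \<in> space S. ?\<phi> (Alg \<delta> lam \<Delta> x w) - minimum ?\<phi> \<le> \<delta>}"
  have G_prob: "measure S G \<ge> 2 / 3"
    using alg assms \<open>?\<phi> x - minimum ?\<phi> \<le> \<Delta>\<close> unfolding is_alg_def G_def by blast
  have [measurable]: "(\<lambda>w. Alg \<delta> lam \<Delta> x w) \<in> S \<rightarrow>\<^sub>M borel"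
    using measurable_compose[OF measurable_Pair1' measurable_Alg[OF assms(1-3)], of x] by simp
  have [measurable]: "?\<phi> \<in> borel_measurable borel"
    unfolding prox_obj_def by measurable
  have G: "G \<in> sets S"
    unfolding G_def by measurable
  let ?y = "\<lambda>\<omega>. fst (alg_R tie Alg \<delta> lam \<Delta> x m \<omega> 0)"
  define r where "r = sqrt (2 * \<delta> / (\<mu> + lam))"
  have r: "r \<ge> 0" "r\<^sup>2 = 2 * \<delta> / (\<mu> + lam)"
    using \<open>\<delta> > 0\<close> c by (simp_all add: r_def)
  have close: "norm (Alg \<delta> lam \<Delta> x w - z') \<le> r" if "w \<in> G" for w
  proof (rule power2_le_imp_le)
    have "(\<mu> + lam) / 2 * (norm (Alg \<delta> lam \<Delta> x w - z'))\<^sup>2 \<le> \<delta>"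
      using lower[of "Alg \<delta> lam \<Delta> x w"] that by (simp add: G_def min)
    then show "(norm (Alg \<delta> lam \<Delta> x w - z'))\<^sup>2 \<le> r\<^sup>2"
      using c by (simp add: r field_simps)
  qed (rule r)
  have select: "(norm (?y \<omega> - z'))\<^sup>2 \<le> 18 * \<delta> / (\<mu> + lam)"
    if \<omega>: "real (card {k. k < m \<and> \<omega> k \<in> G}) > real m / 2" for \<omega>
  proof -
    define ys where "ys = map (\<lambda>k. Alg \<delta> lam \<Delta> x (\<omega> k)) [0..<m]"
    have "finite (radius_minimizers ys)"
      by (auto simp: radius_minimizers_def)
    then have "tie (radius_minimizers ys) \<in> radius_minimizers ys"
      using m_pos by (intro tie radius_minimizers_nonempty) (auto simp: ys_def)
    moreover have "card {k. k < m \<and> \<omega> k \<in> G} \<le> card {k. k < length ys \<and> norm (ys ! k - z') \<le> r}"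
      by (intro card_mono) (auto simp: ys_def close)
    then have "real (card {k. k < length ys \<and> norm (ys ! k - z') \<le> r}) > real (length ys) / 2"
      using \<omega> by (simp add: ys_def)
    ultimately have "norm (?y \<omega> - z') \<le> 3 * r"
      using radius_minimizer_close by (fastforce simp: alg_R_eq Let_def ys_def)
    then have "(norm (?y \<omega> - z'))\<^sup>2 \<le> (3 * r)\<^sup>2"
      by (intro power_mono) auto
    then show ?thesis
      by (simp add: power_mult_distrib r)
  qed
  show thesis
  proof (rule that)
    show "f z' - minimum f \<le> a"
      using f_le[of z'] near_opt by linarith
    show "f y - minimum f \<le> 9 * \<delta> * ((L + lam) / (\<mu> + lam)) + a"
      if "(norm (y - z'))\<^sup>2 \<le> 18 * \<delta> / (\<mu> + lam)" for y
    proof -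
      have "(L + lam) / 2 \<ge> 0"
        using mu_pos mu_le_L \<open>lam \<ge> 0\<close> by simp
      from mult_left_mono[OF that this]
      have "?\<phi> y - ?\<phi> z' \<le> (L + lam) / 2 * (18 * \<delta> / (\<mu> + lam))"
        using upper[of y] by linarith
      also have "\<dots> = 9 * \<delta> * ((L + lam) / (\<mu> + lam))"
        by simp
      finally show ?thesis
        using f_le[of y] near_opt by linarith
    qed
    have meas: "?y \<in> P \<rightarrow>\<^sub>M borel"
      using measurable_compose[OF measurable_Pair1' measurable_alg_R[OF assms(1-3)], of x] by simp
    have "1 - exp (- real m / 18) \<le>
        measure P {\<omega> \<in> space P. real (card {k. k < m \<and> \<omega> k \<in> G}) > real m / 2}"
      by (rule prob_majority_ge[OF prob_space_seed G G_prob m_pos])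
    also have "\<dots> \<le> measure P {\<omega> \<in> space P. (norm (?y \<omega> - z'))\<^sup>2 \<le> 18 * \<delta> / (\<mu> + lam)}"
      using meas by (intro P.finite_measure_mono) (auto intro: select)
    finally show "1 - exp (- real m / 18) \<le> \<dots>" .
  qed
qed

text \<open>
  The invariant of the loop. It asks for some \<open>z\<close> with the properties of the minimizer of the current
  stage: that minimizer depends on the previous iterates, whereas the invariant is a fixed closed set,
  so the iterates can be treated by Fubini's theorem one stage at a time.
\<close>

definition region :: "(nat \<Rightarrow> real) \<Rightarrow> real \<Rightarrow> nat \<Rightarrow> 'a set" where
  "region lam \<delta> j = {x. f x - minimum f \<le> boost_Delta L \<mu> lam \<delta> j \<and>
    (\<exists>z. f z - minimum f \<le> \<delta> * (\<Sum>i<j. lam i / (\<mu> + case_nat 0 lam i)) \<and>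
      (norm (x - z))\<^sup>2 \<le> 2 * \<delta> / (\<mu> + case_nat 0 lam j))}"

text \<open>The existential describes the Minkowski sum of a closed sublevel set and a compact ball,
  which is closed.\<close>

lemma region_borel: "region lam \<delta> j \<in> sets borel"
proof -
  define a where "a = minimum f + \<delta> * (\<Sum>i<j. lam i / (\<mu> + case_nat 0 lam i))"
  define b where "b = minimum f + boost_Delta L \<mu> lam \<delta> j"
  define r where "r = 2 * \<delta> / (\<mu> + case_nat 0 lam j)"
  have le: "closed {x. f x \<le> c}" for c
    using continuous_on_smooth[OF sm] by (intro closed_Collect_le continuous_intros) auto
  \<comment> \<open>This covers negative \<open>r\<close> too: \<open>sqrt\<close> is then negative
    and both sides fail.\<close>
  have sq: "(norm y)\<^sup>2 \<le> r \<longleftrightarrow> norm y \<le> sqrt r" for y :: 'a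
    by (metis abs_norm_cancel real_sqrt_abs real_sqrt_le_iff)
  have "{x. \<exists>z. f z \<le> a \<and> (norm (x - z))\<^sup>2 \<le> r} = (\<Union>x\<in>{x. f x \<le> a}. \<Union>y\<in>cball 0 (sqrt r). {x + y})"
    unfolding sq
  proof (intro set_eqI iffI)
    fix x
    assume "x \<in> {x. \<exists>z. f z \<le> a \<and> norm (x - z) \<le> sqrt r}"
    then obtain z where "f z \<le> a" "norm (x - z) \<le> sqrt r"
      by blast
    then show "x \<in> (\<Union>x\<in>{x. f x \<le> a}. \<Union>y\<in>cball 0 (sqrt r). {x + y})"
      by (auto intro!: exI[of _ z] bexI[of _ "x - z"])
  qed auto
  then have "closed {x. \<exists>z. f z \<le> a \<and> (norm (x - z))\<^sup>2 \<le> r}"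
    using closed_compact_sums[OF le[of a] compact_cball[of 0 "sqrt r"]] by simp
  moreover have "region lam \<delta> j = {x. f x \<le> b} \<inter> {x. \<exists>z. f z \<le> a \<and> (norm (x - z))\<^sup>2 \<le> r}"
    unfolding region_def a_def b_def r_def by (auto simp: algebra_simps)
  ultimately show ?thesis
    using le by (auto intro: closed_Int)
qed

section \<open>Propagation of the invariant through the stages\<close>

lemma boost_Delta_pos:
  assumes "\<delta> > 0" "\<And>i. i < j \<Longrightarrow> lam i \<ge> 0"
  shows "boost_Delta L \<mu> lam \<delta> j > 0"
proof -
  have nonneg: "case_nat 0 lam i \<ge> 0" if "i \<le> j" for i
    using assms(2) that by (auto split: nat.split)
  have "(L + case_nat 0 lam j) / (\<mu> + case_nat 0 lam j) > 0"
    using mu_pos mu_le_L nonneg[of j] by (intro divide_pos_pos) auto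
  moreover have "(\<Sum>i<j. lam i / (\<mu> + case_nat 0 lam i)) \<ge> 0"
    using mu_pos nonneg assms(2) by (intro sum_nonneg divide_nonneg_nonneg) (auto simp: add_nonneg_nonneg)
  ultimately show ?thesis
    unfolding boost_Delta_def using \<open>\<delta> > 0\<close> by (intro mult_pos_pos add_pos_nonneg)
qed

text \<open>One step of the telescoping: the witness of the current region, used as test point of
  the next objective, pays a penalty of at most the next summand.\<close>

lemma region_prox_obj:
  assumes "x \<in> region lam \<delta> j" "\<And>i. i \<le> j \<Longrightarrow> lam i \<ge> 0"
  obtains z where "prox_obj f (lam j) x z - minimum f \<le>
    \<delta> * (\<Sum>i<Suc j. lam i / (\<mu> + case_nat 0 lam i))"
proof -
  obtain z where z: "f z - minimum f \<le> \<delta> * (\<Sum>i<j. lam i / (\<mu> + case_nat 0 lam i))"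
    "(norm (x - z))\<^sup>2 \<le> 2 * \<delta> / (\<mu> + case_nat 0 lam j)"
    using assms(1) unfolding region_def by blast
  have "lam j / 2 * (norm (z - x))\<^sup>2 \<le> lam j / 2 * (2 * \<delta> / (\<mu> + case_nat 0 lam j))"
    using z(2) assms(2)[of j] by (intro mult_left_mono) (simp_all add: norm_minus_commute)
  also have "\<dots> = \<delta> * (lam j / (\<mu> + case_nat 0 lam j))"
    by simp
  finally have "prox_obj f (lam j) x z - minimum f \<le>
      \<delta> * (\<Sum>i<Suc j. lam i / (\<mu> + case_nat 0 lam i))"
    unfolding prox_obj_def sum.lessThan_Suc distrib_left using z(1) by linarith
  then show thesis
    by (rule that)
qed

text \<open>The bound \<open>Suc i < j\<close> reflects the index shift: \<open>j\<close> stages use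
  weights of index at most \<open>j - 2\<close>.\<close>

lemma measurable_boost_loop:
  assumes "\<delta> > 0" "\<Delta>in > 0" "\<And>i. Suc i < j \<Longrightarrow> lam i \<ge> 0"
  shows "(\<lambda>\<omega>. fst (boost_loop tie Alg L \<mu> lam \<delta> \<Delta>in xin m j \<omega> 0)) \<in> P \<rightarrow>\<^sub>M borel"
  using assms(3)
proof (induction j)
  case (Suc j)
  have [measurable]: "(\<lambda>\<omega>. fst (boost_loop tie Alg L \<mu> lam \<delta> \<Delta>in xin m j \<omega> 0)) \<in> P \<rightarrow>\<^sub>M borel"
    using Suc by simp
  have [measurable]: "(\<lambda>\<omega> k. \<omega> (j * m + k)) \<in> P \<rightarrow>\<^sub>M P"
    by (rule measurable_PiM_single') (auto simp: space_PiM)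
  have "(\<lambda>(x, \<omega>). fst (alg_R tie Alg (\<delta> / 9) (case_nat 0 lam j)
      (case_nat \<Delta>in (boost_Delta L \<mu> lam \<delta>) j) x m \<omega> 0)) \<in> borel \<Otimes>\<^sub>M P \<rightarrow>\<^sub>M borel"
    using assms Suc.prems by (intro measurable_alg_R) (auto split: nat.split intro!: boost_Delta_pos)
  note [measurable] = this
  show ?case
    unfolding fst_boost_loop_Suc by measurable
qed simp

lemma measurable_boost_alg:
  assumes "\<delta> > 0" "\<Delta>in > 0" and lam: "\<And>i. i \<le> T \<Longrightarrow> lam i \<ge> 0"
  shows "(\<lambda>\<omega>. fst (boost_alg tie Alg L \<mu> lam \<delta> \<Delta>in xin T m \<omega> 0)) \<in> P \<rightarrow>\<^sub>M borel"
proof -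
  have [measurable]:
    "(\<lambda>\<omega>. fst (boost_loop tie Alg L \<mu> lam \<delta> \<Delta>in xin m (Suc T) \<omega> 0)) \<in> P \<rightarrow>\<^sub>M borel"
    using assms by (intro measurable_boost_loop) auto
  have [measurable]: "(\<lambda>\<omega> k. \<omega> (Suc T * m + k)) \<in> P \<rightarrow>\<^sub>M P"
    by (rule measurable_PiM_single') (auto simp: space_PiM)
  have "(\<mu> + lam T) / (L + lam T) * (\<delta> / 9) > 0"
    using assms mu_pos mu_le_L lam[of T] by (auto intro!: mult_pos_pos divide_pos_pos add_pos_nonneg)
  then have "(\<lambda>(x, \<omega>). fst (alg_R tie Alg ((\<mu> + lam T) / (L + lam T) * (\<delta> / 9)) (lam T)
      (boost_Delta L \<mu> lam \<delta> T) x m \<omega> 0)) \<in> borel \<Otimes>\<^sub>M P \<rightarrow>\<^sub>M borel"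
    using assms by (intro measurable_alg_R boost_Delta_pos) auto
  note [measurable] = this
  show ?thesis
    unfolding fst_boost_alg by measurable
qed

text \<open>Calling with \<open>\<delta> / 9\<close> makes the constants of
  \<open>alg_R_accuracy\<close> fit: \<open>9 * (\<delta> / 9)\<close> is the
  \<open>\<delta>\<close> of \<open>boost_Delta\<close> and \<open>18 * (\<delta> / 9)\<close> the
  \<open>2 * \<delta>\<close> of \<open>region\<close>. The proximal minimizer is the
  witness.\<close>

lemma alg_R_region:
  assumes "\<delta> > 0" "\<Delta> > 0" "\<And>i. i < j \<Longrightarrow> lam i \<ge> 0" and gap: "f x - minimum f \<le> \<Delta>"
    and z: "prox_obj f (case_nat 0 lam j) x z - minimum f \<le>
      \<delta> * (\<Sum>i<j. lam i / (\<mu> + case_nat 0 lam i))"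
  shows "measure P {\<omega> \<in> space P.
      fst (alg_R tie Alg (\<delta> / 9) (case_nat 0 lam j) \<Delta> x m \<omega> 0) \<in> region lam \<delta> j}
    \<ge> 1 - exp (- real m / 18)"
proof -
  let ?l = "case_nat 0 lam j"
  let ?y = "\<lambda>\<omega>. fst (alg_R tie Alg (\<delta> / 9) ?l \<Delta> x m \<omega> 0)"
  have nonneg: "\<delta> / 9 > 0" "?l \<ge> 0"
    using assms by (auto split: nat.split)
  obtain z' where z': "f z' - minimum f \<le> \<delta> * (\<Sum>i<j. lam i / (\<mu> + case_nat 0 lam i))"
    "\<And>y. (norm (y - z'))\<^sup>2 \<le> 18 * (\<delta> / 9) / (\<mu> + ?l) \<Longrightarrow>
      f y - minimum f \<le> 9 * (\<delta> / 9) * ((L + ?l) / (\<mu> + ?l))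
        + \<delta> * (\<Sum>i<j. lam i / (\<mu> + case_nat 0 lam i))"
    "measure P {\<omega> \<in> space P. (norm (?y \<omega> - z'))\<^sup>2 \<le> 18 * (\<delta> / 9) / (\<mu> + ?l)}
      \<ge> 1 - exp (- real m / 18)"
    by (rule alg_R_accuracy[OF nonneg \<open>\<Delta> > 0\<close> gap z]) (rule that)
  have region: "y \<in> region lam \<delta> j" if "(norm (y - z'))\<^sup>2 \<le> 18 * (\<delta> / 9) / (\<mu> + ?l)" for y
    using z'(1) z'(2)[OF that] that
    unfolding region_def boost_Delta_def by (auto simp: distrib_left intro!: exI[of _ z'])
  have meas: "?y \<in> P \<rightarrow>\<^sub>M borel"
    using measurable_compose[OF measurable_Pair1' measurable_alg_R[OF nonneg \<open>\<Delta> > 0\<close>], of x]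
    by simp
  have "measure P {\<omega> \<in> space P. (norm (?y \<omega> - z'))\<^sup>2 \<le> 18 * (\<delta> / 9) / (\<mu> + ?l)} \<le>
      measure P {\<omega> \<in> space P. ?y \<omega> \<in> region lam \<delta> j}"
    using measurable_sets_Collect[OF meas] region_borel meas
    by (intro P.finite_measure_mono) (auto intro: region)
  with z'(3) show ?thesis
    by linarith
qed

text \<open>By induction, \<open>prob_fresh_step_ge\<close> starts each stage from an iterate in the
  previous region; failure probabilities add up at most.\<close>

lemma boost_loop_region:
  assumes "\<delta> > 0" "\<Delta>in > 0" "f xin - minimum f \<le> \<Delta>in" "\<And>i. i < j \<Longrightarrow> lam i \<ge> 0"
  shows "measure P {\<omega> \<in> space P.
      fst (boost_loop tie Alg L \<mu> lam \<delta> \<Delta>in xin m (Suc j) \<omega> 0) \<in> region lam \<delta> j}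
    \<ge> 1 - (real j + 1) * exp (- real m / 18)"
  using assms(4)
proof (induction j)
  case 0
  \<comment> \<open>At stage 0 the weight is 0 and the sum is empty, so the proximal objective is
    \<open>f\<close> and its minimizer serves as test point.\<close>
  obtain z where "minimum f = f z"
    using strongly_convex_smooth_minimizer[OF mu_pos sc sm] by metis
  with alg_R_region[of \<delta> \<Delta>in 0 lam xin z] assms show ?case
    by (simp add: fst_boost_loop_Suc prox_obj_def del: boost_loop.simps(2))
next
  case (Suc j)
  define q where "q = exp (- real m / 18)"
  have q: "0 \<le> q" "q \<le> 1"
    by (simp_all add: q_def)
  have pos: "boost_Delta L \<mu> lam \<delta> j > 0"
    using assms(1) Suc.prems by (intro boost_Delta_pos) auto
  have "measure P {\<omega> \<in> space P.
      fst (boost_loop tie Alg L \<mu> lam \<delta> \<Delta>in xin m (Suc (Suc j)) \<omega> 0) \<in> region lam \<delta> (Suc j)}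
    \<ge> (1 - (real j + 1) * q) * (1 - q)"
    unfolding fst_boost_loop_Suc[of _ _ _ _ _ _ _ _ _ "Suc j"]
  proof (rule prob_fresh_step_ge[OF prob_space_seed,
      where X = "\<lambda>\<omega>. fst (boost_loop tie Alg L \<mu> lam \<delta> \<Delta>in xin m (Suc j) \<omega> 0)" and
        R = "\<lambda>x \<omega>. fst (alg_R tie Alg (\<delta> / 9) (case_nat 0 lam (Suc j))
          (case_nat \<Delta>in (boost_Delta L \<mu> lam \<delta>) (Suc j)) x m \<omega> 0)" and
        K = "region lam \<delta> j"])
    show "(\<lambda>\<omega>. fst (boost_loop tie Alg L \<mu> lam \<delta> \<Delta>in xin m (Suc j) \<omega> 0)) \<in> P \<rightarrow>\<^sub>M borel"
      using assms Suc.prems by (intro measurable_boost_loop) auto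
    show "(\<lambda>(x, \<omega>). fst (alg_R tie Alg (\<delta> / 9) (case_nat 0 lam (Suc j))
        (case_nat \<Delta>in (boost_Delta L \<mu> lam \<delta>) (Suc j)) x m \<omega> 0)) \<in> borel \<Otimes>\<^sub>M P \<rightarrow>\<^sub>M borel"
      using assms Suc.prems pos by (intro measurable_alg_R) auto
    show "fst (boost_loop tie Alg L \<mu> lam \<delta> \<Delta>in xin m (Suc j) \<omega> 0) =
        fst (boost_loop tie Alg L \<mu> lam \<delta> \<Delta>in xin m (Suc j) \<omega>' 0)"
      if "\<And>k. k < Suc j * m \<Longrightarrow> \<omega> k = \<omega>' k" for \<omega> \<omega>'
      using that by (rule boost_loop_cong)
    show "1 - (real j + 1) * q \<le> measure P {\<omega> \<in> space P.
        fst (boost_loop tie Alg L \<mu> lam \<delta> \<Delta>in xin m (Suc j) \<omega> 0) \<in> region lam \<delta> j}"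
      unfolding q_def using Suc by simp
    show "1 - q \<le> measure P {\<omega> \<in> space P. fst (alg_R tie Alg (\<delta> / 9) (case_nat 0 lam (Suc j))
        (case_nat \<Delta>in (boost_Delta L \<mu> lam \<delta>) (Suc j)) x m \<omega> 0) \<in> region lam \<delta> (Suc j)}"
      if "x \<in> region lam \<delta> j" for x
    proof -
      from that obtain z where "prox_obj f (lam j) x z - minimum f \<le>
          \<delta> * (\<Sum>i<Suc j. lam i / (\<mu> + case_nat 0 lam i))"
        by (rule region_prox_obj) (use Suc.prems in auto)
      moreover have "f x - minimum f \<le> boost_Delta L \<mu> lam \<delta> j"
        using that by (simp add: region_def)
      ultimately show ?thesis
        unfolding q_def using alg_R_region[of \<delta> "boost_Delta L \<mu> lam \<delta> j" "Suc j" lam x z]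
          assms(1) Suc.prems pos by simp
    qed
  qed (simp_all only: q diff_ge_0_iff_ge region_borel )
  \<comment> \<open>The product exceeds the linear expression by
    \<open>(real j + 1) * q\<^sup>2\<close>.\<close>
  moreover have "1 - (real (Suc j) + 1) * q \<le> (1 - (real j + 1) * q) * (1 - q)"
    using q by (simp add: algebra_simps)
  ultimately show ?case
    unfolding q_def by linarith
qed

text \<open>The last of the \<open>T + 2\<close> stages is judged by value only, so its target is
  the sublevel set \<open>K\<close>, with no distance condition to pass on.\<close>

lemma boost_alg_prob:
  assumes "\<delta> > 0" "\<Delta>in > 0" "f xin - minimum f \<le> \<Delta>in" and lam: "\<And>i. i \<le> T \<Longrightarrow> lam i \<ge> 0"
  shows "measure P {\<omega> \<in> space P.
      f (fst (boost_alg tie Alg L \<mu> lam \<delta> \<Delta>in xin T m \<omega> 0)) - minimum f \<le>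
        \<delta> * (1 + (\<Sum>i<Suc T. lam i / (\<mu> + case_nat 0 lam i)))}
    \<ge> 1 - (real T + 2) * exp (- real m / 18)"
proof -
  define q where "q = exp (- real m / 18)"
  have q: "0 \<le> q" "q \<le> 1"
    by (simp_all add: q_def)
  define \<delta>' where "\<delta>' = (\<mu> + lam T) / (L + lam T) * (\<delta> / 9)"
  define a where "a = \<delta> * (\<Sum>i<Suc T. lam i / (\<mu> + case_nat 0 lam i))"
  define K where "K = {y. f y - minimum f \<le> \<delta> + a}"
  have pos: "boost_Delta L \<mu> lam \<delta> T > 0" "\<mu> + lam T > 0" "L + lam T > 0"
    using assms mu_pos mu_le_L lam[of T] by (auto intro!: boost_Delta_pos add_pos_nonneg)
  then have "\<delta>' > 0"
    using \<open>\<delta> > 0\<close> by (simp add: \<delta>'_def)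
  note params = this lam[OF order_refl] pos(1)
  have K [measurable]: "K \<in> sets borel"
    unfolding K_def by measurable
  have "measure P {\<omega> \<in> space P. fst (boost_alg tie Alg L \<mu> lam \<delta> \<Delta>in xin T m \<omega> 0) \<in> K}
    \<ge> (1 - (real T + 1) * q) * (1 - q)"
    unfolding fst_boost_alg \<delta>'_def[symmetric]
  proof (rule prob_fresh_step_ge[OF prob_space_seed,
      where X = "\<lambda>\<omega>. fst (boost_loop tie Alg L \<mu> lam \<delta> \<Delta>in xin m (Suc T) \<omega> 0)" and
        R = "\<lambda>x \<omega>. fst (alg_R tie Alg \<delta>' (lam T) (boost_Delta L \<mu> lam \<delta> T) x m \<omega> 0)" and
        K = "region lam \<delta> T"])
    show "(\<lambda>\<omega>. fst (boost_loop tie Alg L \<mu> lam \<delta> \<Delta>in xin m (Suc T) \<omega> 0)) \<in> P \<rightarrow>\<^sub>M borel"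
      using assms by (intro measurable_boost_loop) auto
    show "(\<lambda>(x, \<omega>). fst (alg_R tie Alg \<delta>' (lam T) (boost_Delta L \<mu> lam \<delta> T) x m \<omega> 0))
        \<in> borel \<Otimes>\<^sub>M P \<rightarrow>\<^sub>M borel"
      by (rule measurable_alg_R[OF params])
    show "fst (boost_loop tie Alg L \<mu> lam \<delta> \<Delta>in xin m (Suc T) \<omega> 0) =
        fst (boost_loop tie Alg L \<mu> lam \<delta> \<Delta>in xin m (Suc T) \<omega>' 0)"
      if "\<And>k. k < Suc T * m \<Longrightarrow> \<omega> k = \<omega>' k" for \<omega> \<omega>'
      using that by (rule boost_loop_cong)
    show "1 - (real T + 1) * q \<le> measure P {\<omega> \<in> space P.
        fst (boost_loop tie Alg L \<mu> lam \<delta> \<Delta>in xin m (Suc T) \<omega> 0) \<in> region lam \<delta> T}"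
      unfolding q_def by (rule boost_loop_region) (use assms in auto)
    show "1 - q \<le> measure P {\<omega> \<in> space P.
        fst (alg_R tie Alg \<delta>' (lam T) (boost_Delta L \<mu> lam \<delta> T) x m \<omega> 0) \<in> K}"
      if "x \<in> region lam \<delta> T" for x
    proof -
      let ?y = "\<lambda>\<omega>. fst (alg_R tie Alg \<delta>' (lam T) (boost_Delta L \<mu> lam \<delta> T) x m \<omega> 0)"
      have gap: "f x - minimum f \<le> boost_Delta L \<mu> lam \<delta> T"
        using that by (simp add: region_def)
      from that obtain z where z: "prox_obj f (lam T) x z - minimum f \<le> a"
        unfolding a_def by (rule region_prox_obj) (use lam in auto)
      obtain z' where z': "\<And>y. (norm (y - z'))\<^sup>2 \<le> 18 * \<delta>' / (\<mu> + lam T) \<Longrightarrow>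
          f y - minimum f \<le> 9 * \<delta>' * ((L + lam T) / (\<mu> + lam T)) + a"
        "measure P {\<omega> \<in> space P. (norm (?y \<omega> - z'))\<^sup>2 \<le> 18 * \<delta>' / (\<mu> + lam T)}
          \<ge> 1 - exp (- real m / 18)"
        by (rule alg_R_accuracy[OF params gap z]) (rule that)
      \<comment> \<open>The accuracy \<open>\<delta>'\<close> cancels both the condition number of
        the last objective and the factor 9 of the selection.\<close>
      have "9 * (u / v * (\<delta> / 9)) * (v / u) = \<delta>" if "u > 0" "v > 0" for u v
        using that by simp
      from this[OF pos(2,3)] have "9 * \<delta>' * ((L + lam T) / (\<mu> + lam T)) = \<delta>"
        by (simp only: \<delta>'_def)
      then have in_K: "y \<in> K" if "(norm (y - z'))\<^sup>2 \<le> 18 * \<delta>' / (\<mu> + lam T)" for y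
        using z'(1)[OF that] by (simp add: K_def)
      have meas: "?y \<in> P \<rightarrow>\<^sub>M borel"
        using measurable_compose[OF measurable_Pair1' measurable_alg_R[OF params], of x] by simp
      have "measure P {\<omega> \<in> space P. (norm (?y \<omega> - z'))\<^sup>2 \<le> 18 * \<delta>' / (\<mu> + lam T)} \<le>
          measure P {\<omega> \<in> space P. ?y \<omega> \<in> K}"
        using measurable_sets_Collect[OF meas] K meas
        by (intro P.finite_measure_mono) (auto intro: in_K)
      with z'(2) show ?thesis
        unfolding q_def by linarith
    qed
  qed (simp_all only: q diff_ge_0_iff_ge region_borel K)
  moreover have "1 - (real T + 2) * q \<le> (1 - (real T + 1) * q) * (1 - q)"
    using q by (simp add: algebra_simps)
  ultimately show ?thesis
    unfolding q_def K_def a_def by (simp add: distrib_left)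
qed

end

section \<open>Choice of the parameters and the error budget\<close>

lemma geometric_ratio_sum_le:
  fixes \<mu> :: real
  assumes "\<mu> > 0" "\<And>i. i \<le> n \<Longrightarrow> lam i = \<mu> * 2 ^ i"
  shows "(\<Sum>i<Suc n. lam i / (\<mu> + case_nat 0 lam i)) \<le> 1 + 2 * real n"
  using assms(2)
proof (induction n)
  case (Suc n)
  \<comment> \<open>The weights double, which bounds every ratio after the first by 2; the first,
    \<open>lam 0 / \<mu>\<close>, is 1.\<close>
  have "lam (Suc n) / (\<mu> + lam n) \<le> 2"
    using assms(1) Suc.prems[of n] Suc.prems[of "Suc n"] by (simp add: divide_le_eq add_pos_pos)
  with Suc show ?case
    by simp
qed (use assms(1) in simp)

theorem corollary5p3:
  fixes f :: "'a::euclidean_space \<Rightarrow> real"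
    and Alg :: "('a, 'w) proc" and S :: "'w measure"
    and tie :: "nat set \<Rightarrow> nat"
    and \<mu> L \<kappa> \<Delta>in \<epsilon> p \<delta> :: real and xin :: 'a
    and T m :: nat and lam :: "nat \<Rightarrow> real"
  assumes "\<mu> > 0" and "strongly_convex \<mu> f" and "smooth L f" and "\<kappa> = L / \<mu>"
    and "is_alg f S Alg"
    and "\<And>I. finite I \<Longrightarrow> I \<noteq> {} \<Longrightarrow> tie I \<in> I"
    and "\<Delta>in > 0" and "\<Delta>in \<ge> f xin - minimum f"
    and "\<epsilon> > 0" and "0 < p" and "p < 1"
    and "T = nat \<lceil>log 2 \<kappa>\<rceil>"
    and "m = nat \<lceil>18 * ln ((2 + real T) / p)\<rceil>"
    and "\<delta> = \<epsilon> / (2 + 2 * real T)"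
    and "\<And>i. i \<le> T \<Longrightarrow> lam i = \<mu> * 2 ^ i"
  shows "\<P>(\<omega> in (\<Pi>\<^sub>M i\<in>(UNIV :: nat set). S).
             f (fst (boost_alg tie Alg L \<mu> lam \<delta> \<Delta>in xin T m \<omega> 0)) - minimum f \<le> \<epsilon>) \<ge> 1 - p
       \<and> (\<forall>\<omega>. int (snd (boost_alg tie Alg L \<mu> lam \<delta> \<Delta>in xin T m \<omega> 0)) =
             \<lceil>18 * ln (real_of_int \<lceil>2 + log 2 \<kappa>\<rceil> / p)\<rceil> * \<lceil>2 + log 2 \<kappa>\<rceil>)
       \<and> (MAX i\<in>{0..T + 1}. boost_Delta L \<mu> lam \<delta> i) \<le>
           (\<kappa> + 1 + 2 * real_of_int \<lceil>log 2 \<kappa>\<rceil>) / (2 + 2 * real_of_int \<lceil>log 2 \<kappa>\<rceil>) * \<epsilon>"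
proof -
  have \<mu>: "\<mu> > 0" and \<epsilon>: "\<epsilon> > 0" and p: "0 < p" "p < 1"
    and m: "m = nat \<lceil>18 * ln ((2 + real T) / p)\<rceil>" and \<delta>: "\<delta> = \<epsilon> / (2 + 2 * real T)"
    and lam: "\<And>i. i \<le> T \<Longrightarrow> lam i = \<mu> * 2 ^ i"
    by fact+
  have "\<mu> \<le> L"
    using assms(1-3) by (rule strongly_convex_smooth_le)
  then have "\<kappa> \<ge> 1"
    using \<mu> assms(4) by simp
  then have "log 2 \<kappa> \<ge> 0"
    by simp
  \<comment> \<open>Hence \<open>nat\<close> loses nothing in the definition of
    \<open>T\<close>.\<close>
  then have "\<lceil>log 2 \<kappa>\<rceil> \<ge> 0"
    by linarith
  then have T: "\<lceil>log 2 \<kappa>\<rceil> = int T"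
    using assms(12) by simp
  have T2: "\<lceil>2 + log 2 \<kappa>\<rceil> = 2 + int T"
    using T ceiling_add_numeral[of "log 2 \<kappa>" "num.Bit0 num.One"] by (simp add: add.commute)
  define x where "x = (2 + real T) / p"
  \<comment> \<open>Then \<open>ln x\<close> is positive, which gives \<open>m > 0\<close> and makes
    \<open>nat\<close> harmless in the call count.\<close>
  have x: "x > 1"
    using p by (simp add: x_def)
  have "m > 0"
    using x by (simp add: m x_def[symmetric])
  have m_int: "int m = \<lceil>18 * ln x\<rceil>"
    using ln_gt_zero[OF x] by (simp add: m x_def[symmetric])
  \<comment> \<open>With this \<open>m\<close> each of the \<open>T + 2\<close> stages may fail with
    probability at most \<open>p / (2 + T)\<close>.\<close>
  have "real_of_int (int m) \<ge> 18 * ln x"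
    unfolding m_int by (rule le_of_int_ceiling)
  then have "exp (- real m / 18) \<le> exp (- ln x)"
    by simp
  also have "\<dots> = p / (2 + real T)"
    using x by (simp add: exp_minus x_def)
  finally have fail: "(real T + 2) * exp (- real m / 18) \<le> p"
    by (simp add: field_simps)
  have "\<delta> > 0"
    using \<epsilon> by (simp add: \<delta> add_pos_nonneg)
  \<comment> \<open>The budget consists of \<open>\<delta>\<close> for the last stage and
    \<open>\<delta> * (1 + 2 * T)\<close> for the sum of ratios.\<close>
  have \<epsilon>_eq: "\<epsilon> = \<delta> * (2 + 2 * real T)"
    by (simp add: \<delta> add_nonneg_eq_0_iff)
  have lam_nonneg: "lam i \<ge> 0" if "i \<le> T" for i
    using \<mu> lam[OF that] by simp
  interpret boost_setting f Alg S tie \<mu> L m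
    using assms(1-3,5,6) \<open>m > 0\<close> by unfold_locales
  let ?x = "\<lambda>\<omega>. fst (boost_alg tie Alg L \<mu> lam \<delta> \<Delta>in xin T m \<omega> 0)"
  have meas: "?x \<in> P \<rightarrow>\<^sub>M borel"
    using \<open>\<delta> > 0\<close> assms(7) lam_nonneg by (intro measurable_boost_alg) auto
  have "1 - p \<le> 1 - (real T + 2) * exp (- real m / 18)"
    using fail by simp
  also have "\<dots> \<le> measure P {\<omega> \<in> space P. f (?x \<omega>) - minimum f \<le>
        \<delta> * (1 + (\<Sum>i<Suc T. lam i / (\<mu> + case_nat 0 lam i)))}"
    by (rule boost_alg_prob) (use \<open>\<delta> > 0\<close> assms(7,8) lam_nonneg in auto)
  also have "\<dots> \<le> measure P {\<omega> \<in> space P. f (?x \<omega>) - minimum f \<le> \<epsilon>}"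
  proof (rule P.finite_measure_mono)
    have "1 + (\<Sum>i<Suc T. lam i / (\<mu> + case_nat 0 lam i)) \<le> 2 + 2 * real T"
      using geometric_ratio_sum_le[OF \<mu> lam] by simp
    then have "\<delta> * (1 + (\<Sum>i<Suc T. lam i / (\<mu> + case_nat 0 lam i))) \<le> \<epsilon>"
      unfolding \<epsilon>_eq using \<open>\<delta> > 0\<close> by (intro mult_left_mono) auto
    then show "{\<omega> \<in> space P. f (?x \<omega>) - minimum f \<le>
        \<delta> * (1 + (\<Sum>i<Suc T. lam i / (\<mu> + case_nat 0 lam i)))} \<subseteq>
      {\<omega> \<in> space P. f (?x \<omega>) - minimum f \<le> \<epsilon>}"
      by auto
    show "{\<omega> \<in> space P. f (?x \<omega>) - minimum f \<le> \<epsilon>} \<in> sets P"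
      using meas by measurable
  qed
  finally have prob: "1 - p \<le> measure P {\<omega> \<in> space P. f (?x \<omega>) - minimum f \<le> \<epsilon>}" .
  have calls: "int (snd (boost_alg tie Alg L \<mu> lam \<delta> \<Delta>in xin T m \<omega> 0)) =
      \<lceil>18 * ln (real_of_int \<lceil>2 + log 2 \<kappa>\<rceil> / p)\<rceil> * \<lceil>2 + log 2 \<kappa>\<rceil>" for \<omega>
    unfolding T2 snd_boost_alg using m_int by (simp add: x_def algebra_simps)
  have "boost_Delta L \<mu> lam \<delta> j \<le> \<delta> * (\<kappa> + (1 + 2 * real T))" if "j \<le> T + 1" for j
  proof -
    \<comment> \<open>By the index shift, \<open>j = T + 1\<close> involves \<open>lam T\<close>,
      the last weight specified.\<close>
    have c: "case_nat 0 lam j \<ge> 0"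
      using that lam_nonneg by (auto split: nat.split)
    \<comment> \<open>The ratio is largest at weight 0, where it equals \<open>\<kappa>\<close>;
      cross-multiplying leaves exactly this inequality.\<close>
    have "\<mu> * case_nat 0 lam j \<le> L * case_nat 0 lam j"
      using \<open>\<mu> \<le> L\<close> c by (rule mult_right_mono)
    then have "(L + case_nat 0 lam j) / (\<mu> + case_nat 0 lam j) \<le> \<kappa>"
      using \<mu> c assms(4) by (simp add: divide_le_eq le_divide_eq add_pos_nonneg algebra_simps)
    moreover have "(\<Sum>i<j. lam i / (\<mu> + case_nat 0 lam i)) \<le> 1 + 2 * real T"
    proof (cases j)
      case (Suc n)
      with that have "(\<Sum>i<j. lam i / (\<mu> + case_nat 0 lam i)) \<le> 1 + 2 * real n"
        using geometric_ratio_sum_le[OF \<mu>, of n lam] lam by simp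
      with Suc that show ?thesis
        by simp
    qed simp
    ultimately show ?thesis
      unfolding boost_Delta_def using \<open>\<delta> > 0\<close> by (intro mult_left_mono add_mono) auto
  qed
  then have "(MAX i\<in>{0..T + 1}. boost_Delta L \<mu> lam \<delta> i) \<le> \<delta> * (\<kappa> + (1 + 2 * real T))"
    by (subst Max_le_iff) auto
  also have "\<dots> = (\<kappa> + 1 + 2 * real_of_int \<lceil>log 2 \<kappa>\<rceil>) / (2 + 2 * real_of_int \<lceil>log 2 \<kappa>\<rceil>) * \<epsilon>"
    by (simp add: T \<delta> add.assoc mult.commute)
  finally show ?thesis
    using prob calls by blast
qed

end
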